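(* Let $D$ and $\tilde{D}$ be two closed disks in the Euclidean plane with common center $O$ and with $\tilde{D}\subseteq D$, and let $B = D\setminus \operatorname{Int}\tilde{D}$. Let $P$ be a point of $\tilde{D}$, and let $n\geq 4$ be an even integer. Draw $n$ straight lines through $P$ meeting so as to form $2n$ equal angles (each $\pi/n$), and let $A_1, A_2,\dots,A_{2n}$, in clockwise order, be the intersections of these lines with the boundary of $D$. For $1\le k\le 2n$ let $Piece(A_k)$ denote the area of the part of $B$ lying in the angular sector with vertex $P$ between the consecutive rays $PA_k$ and $PA_{k+1}$ (with $A_{2n+1}=A_1$). Then for each $1\leq k\leq n$, $$Piece(A_k)+Piece(A_{k+n})=\frac{1}{n}\,\operatorname{Area}(B).$$
   Context: All disks are closed disks of positive radius in the Euclidean plane. The set $B$ is called a Baumkuchen. The $n$ lines through $P$ determine $2n$ rays from $P$, listed in clockwise order (the choice of the first ray is arbitrary); consecutive rays make an angle of $\pi/n$, and the $(k+n)$-th ray is opposite to the $k$-th ray. $A_k$ is the point where the $k$-th ray meets the boundary circle of $D$, and, similarly, $\tilde{A}_k$ is the point where it meets the boundary circle of $\tilde{D}$. The piece whose area is $Piece(A_k)$ is the region $A_kA_{k+1}\tilde{A}_{k+1}\tilde{A}_k$ of $B$, i.e. the intersection of $B$ with the closed angular sector of angle $\pi/n$ at $P$ bounded by the $k$-th and $(k+1)$-st rays (indices modulo $2n$); this description is also the one used when $P$ lies on the boundary of $\tilde{D}$. *)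

theory Defs
  imports "HOL-Analysis.Analysis"
begin

definition area :: "(real^2) set \<Rightarrow> real" where
  "area S = measure lebesgue S"

definition ray :: "real^2 \<Rightarrow> real \<Rightarrow> (real^2) set" where
  "ray P t = {P + s *\<^sub>R vector [cos t, sin t] | s. 0 \<le> s}"

text \<open>
  The argument of the \<open>k\<close>-th of the \<open>2 n\<close> rays cut out at a common point by \<open>n\<close> equiangular
  lines. It decreases with \<open>k\<close>, so the rays are numbered clockwise; the offset \<open>\<alpha>\<close> is the
  argument of the ray of index \<open>0\<close>, which is also the ray of index \<open>2 n\<close>. Indices are
  automatically cyclic modulo \<open>2 n\<close>, and the rays of indices \<open>k\<close> and \<open>k + n\<close> are opposite.
\<close>

definition ray_arg :: "real \<Rightarrow> nat \<Rightarrow> nat \<Rightarrow> real" where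
  "ray_arg \<alpha> n k = \<alpha> - real k * (pi / real n)"

definition angular_sector :: "real^2 \<Rightarrow> real \<Rightarrow> real \<Rightarrow> (real^2) set" where
  "angular_sector P a b = (\<Union>t\<in>{a..b}. ray P t)"

text \<open>
  By the clockwise numbering, the ray of index \<open>k + 1\<close> has the smaller argument. The piece is
  described by its bounding rays and not by their endpoints on the outer circle, so that it is
  unambiguous also when \<open>P\<close> lies on one of the circles.
\<close>

definition piece_area :: "(real^2) set \<Rightarrow> real^2 \<Rightarrow> real \<Rightarrow> nat \<Rightarrow> nat \<Rightarrow> real" where
  "piece_area B P \<alpha> n k =
     area (B \<inter> angular_sector P (ray_arg \<alpha> n (k + 1)) (ray_arg \<alpha> n k))"

end

theory Submission
  imports Defs
begin

text \<open>
  In polar coordinates at \<open>P\<close> with the angle \<open>t\<close> and half the squared radius \<open>u\<close>, area is Lebesgue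
  measure in \<open>(u, t)\<close>, so the area of a sector of a disk containing \<open>P\<close> is the integral over \<open>t\<close>
  of \<open>\<rho>(t)\<^sup>2 / 2\<close>, where \<open>\<rho>(t)\<close> is the distance from \<open>P\<close> to the circle. If \<open>w\<close> is the vector from
  the centre to \<open>P\<close> and \<open>c\<close> the radius, then \<open>(\<rho>(t)\<^sup>2 + \<rho>(t + \<pi>)\<^sup>2) / 2 = c\<^sup>2 - |w|\<^sup>2 + 2 (w \<bullet> e\<^sub>t)\<^sup>2\<close>,
  with \<open>e\<^sub>t\<close> the unit vector of angle \<open>t\<close>. Only \<open>c\<^sup>2\<close> depends on the radius, so for the annulus the
  integrand of two opposite sectors is the constant \<open>R\<^sup>2 - r\<^sup>2\<close>.
\<close>

section \<open>Polar coordinates at a point\<close>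

definition unit2 :: "real \<Rightarrow> real^2" where
  "unit2 t = vector [cos t, sin t]"

text \<open>
  The first coordinate is half the squared radius instead of the radius: this makes the Jacobian
  determinant 1.
\<close>

definition polar :: "real^2 \<Rightarrow> real^2 \<Rightarrow> real^2" where
  "polar P v = P + sqrt (2 * v $ 1) *\<^sub>R unit2 (v $ 2)"

lemma unit2_nth [simp]: "unit2 t $ 1 = cos t" "unit2 t $ 2 = sin t"
  by (simp_all add: unit2_def)

lemma inner_unit2 [simp]: "unit2 t \<bullet> unit2 t = 1"
  by (simp add: inner_vec_def sum_2 flip: power2_eq_square)

lemma norm_unit2 [simp]: "norm (unit2 t) = 1"
  by (simp add: norm_eq_sqrt_inner)

lemma unit2_minus_pi: "unit2 (t - pi) = - unit2 t"
  by (simp add: vec_eq_iff forall_2)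

lemma continuous_on_unit2 [continuous_intros]:
  fixes f :: "'a::t2_space \<Rightarrow> real"
  assumes "continuous_on S f"
  shows "continuous_on S (\<lambda>x. unit2 (f x))"
proof -
  have "(\<lambda>x. unit2 (f x)) = (\<lambda>x. \<chi> i. if i = 1 then cos (f x) else sin (f x))"
    by (auto simp: vec_eq_iff forall_2)
  moreover have "continuous_on S (\<lambda>x. if i = 1 then cos (f x) else sin (f x))" for i :: 2
    by (cases "i = 1") (auto intro!: continuous_intros assms)
  ultimately show ?thesis by (simp only: continuous_on_vec_lambda)
qed

lemma continuous_on_polar: "continuous_on S (polar P)"
  unfolding polar_def by (intro continuous_intros)

text \<open>Equal coordinates give \<open>cos (s - t) = 1\<close>, so \<open>s - t\<close> is a
  multiple of \<open>2 * pi\<close>; in an interval shorter than a full turn only the multiple 0 is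
  possible.\<close>

lemma unit2_inj:
  assumes "unit2 s = unit2 t" "s \<in> {a..b}" "t \<in> {a..b}" "b - a < 2 * pi"
  shows "s = t"
proof -
  have "cos s = cos t" "sin s = sin t"
    using assms(1) by (metis unit2_nth)+
  then have "cos (s - t) = 1"
    by (simp add: cos_diff flip: power2_eq_square)
  then obtain m :: int where m: "s - t = of_int m * (2 * pi)"
    by (auto simp: cos_one_2pi_int)
  have "\<bar>of_int m * (2 * pi)\<bar> < 1 * (2 * pi)"
    using assms(2-4) unfolding m[symmetric] by (auto simp: abs_if)
  then have "\<bar>real_of_int m\<bar> < 1"
    by (simp add: abs_mult)
  then have "m = 0" by linarith
  with m show ?thesis by simp
qed

text \<open>The distance from \<open>P\<close> recovers the first coordinate. As it is positive, it
  can be cancelled, and the remaining unit vector determines the angle.\<close>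

lemma inj_on_polar:
  assumes "b - a < 2 * pi"
  shows "inj_on (polar P) {v. 0 < v $ 1 \<and> v $ 2 \<in> {a..b}}"
proof (rule inj_onI, clarify)
  fix v w :: "real^2"
  assume *: "0 < v $ 1" "v $ 2 \<in> {a..b}" "0 < w $ 1" "w $ 2 \<in> {a..b}" and "polar P v = polar P w"
  then have eq: "sqrt (2 * v $ 1) *\<^sub>R unit2 (v $ 2) = sqrt (2 * w $ 1) *\<^sub>R unit2 (w $ 2)"
    by (simp add: polar_def)
  then have "norm (sqrt (2 * v $ 1) *\<^sub>R unit2 (v $ 2)) = norm (sqrt (2 * w $ 1) *\<^sub>R unit2 (w $ 2))"
    by simp
  then have 1: "v $ 1 = w $ 1" using * by simp
  with eq * have "unit2 (v $ 2) = unit2 (w $ 2)" by simp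
  with unit2_inj * assms have "v $ 2 = w $ 2" by blast
  with 1 show "v = w" by (simp add: vec_eq_iff forall_2)
qed

section \<open>Area preservation of the polar map\<close>

text \<open>The two vectors are the radial and the tangential unit vector, scaled by the inverse of
  the radius and by the radius, so the factors cancel in the determinant.\<close>

definition polar_deriv :: "real^2 \<Rightarrow> real^2 \<Rightarrow> real^2" where
  "polar_deriv v h = (h $ 1 / sqrt (2 * v $ 1)) *\<^sub>R vector [cos (v $ 2), sin (v $ 2)]
     + (sqrt (2 * v $ 1) * h $ 2) *\<^sub>R vector [- sin (v $ 2), cos (v $ 2)]"

lemma has_derivative_nth: "((\<lambda>v::real^'n. v $ i) has_derivative (\<lambda>h. h $ i)) F"
  by (rule bounded_linear_imp_has_derivative) (rule bounded_linear_vec_nth)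

lemma has_derivative_polar:
  assumes "0 < v $ 1"
  shows "(polar P has_derivative polar_deriv v) (at v within S)"
proof -
  have "((\<lambda>x. polar P x $ i) has_derivative (\<lambda>h. polar_deriv v h $ i)) (at v within S)" for i
  proof -
    consider "i = 1" | "i = 2" using exhaust_2 by blast
    then show ?thesis
    proof cases
      case 1
      show ?thesis unfolding 1 polar_def polar_deriv_def
        using assms by (auto intro!: derivative_eq_intros has_derivative_nth simp: field_simps)
    next
      case 2
      show ?thesis unfolding 2 polar_def polar_deriv_def
        using assms by (auto intro!: derivative_eq_intros has_derivative_nth simp: field_simps)
    qed
  qed
  then show ?thesis
    by (subst has_derivative_componentwise_within)
       (auto simp: Basis_vec_def inner_axis)
qed

lemma det_polar_deriv:
  assumes "0 < v $ 1"
  shows "det (matrix (polar_deriv v)) = 1"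
  using assms
  by (simp add: det_2 matrix_def polar_deriv_def axis_def flip: power2_eq_square)

text \<open>Change of variables with Jacobian 1. A positive first coordinate avoids the singularity
  at \<open>P\<close>, and the bound on the angles gives injectivity.\<close>

lemma measure_polar_image:
  assumes S: "S \<in> lmeasurable" "S \<subseteq> {v. 0 < v $ 1 \<and> v $ 2 \<in> {a..b}}" and "b - a < 2 * pi"
  shows "polar P ` S \<in> lmeasurable" "measure lebesgue (polar P ` S) = measure lebesgue S"
proof -
  have "polar P ` S \<in> lmeasurable \<and> measure lebesgue (polar P ` S) = measure lebesgue S"
  proof (subst has_measure_differentiable_image)
    show "S \<in> sets lebesgue" using S by blast
    show "(polar P has_derivative polar_deriv v) (at v within S)" if "v \<in> S" for v
      using that S by (intro has_derivative_polar) auto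
    show "inj_on (polar P) S"
      using inj_on_polar[OF assms(3)] S(2) by (rule inj_on_subset)
    have "((\<lambda>x. 1::real) has_integral measure lebesgue S) S"
      using S(1) by (metis has_integral_integral integrable_on_const lmeasure_integral)
    then show "((\<lambda>x. \<bar>det (matrix (polar_deriv x))\<bar>) has_integral measure lebesgue S) S"
      by (rule has_integral_eq_rhs[OF has_integral_eq, rotated]) (use S det_polar_deriv in auto)
  qed
  then show "polar P ` S \<in> lmeasurable" "measure lebesgue (polar P ` S) = measure lebesgue S" by auto
qed

section \<open>Iterated integration on \<open>real^2\<close>\<close>

lemma measurable_vec2 [measurable]:
  "(\<lambda>(x, y). vector [x, y] :: real^2) \<in> borel_measurable (borel :: (real \<times> real) measure)"
proof (rule borel_measurable_continuous_onI)
  have "(\<lambda>(x, y). vector [x, y] :: real^2) = (\<lambda>z. \<chi> i. if i = 1 then fst z else snd z)"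
    by (auto simp: vec_eq_iff forall_2 fun_eq_iff)
  moreover have "continuous_on UNIV (\<lambda>z::real\<times>real. if i = 1 then fst z else snd z)" for i :: 2
    by (cases "i = 1") (auto intro!: continuous_intros)
  ultimately show "continuous_on UNIV (\<lambda>(x, y). vector [x, y] :: real^2)"
    by (simp add: continuous_on_vec_lambda)
qed

text \<open>Lebesgue measure is determined by its values on boxes, and \<open>vector\<close> pulls a
  box back to a box with the same sides. This carries Tonelli from pairs over to
  \<open>real^2\<close>.\<close>

lemma lborel_vec2:
  "distr (lborel :: (real \<times> real) measure) borel (\<lambda>(x, y). vector [x, y]) = (lborel :: (real^2) measure)"
proof (rule lborel_eqI[symmetric])
  fix l u :: "real^2"
  assume lu: "\<And>b. b \<in> Basis \<Longrightarrow> l \<bullet> b \<le> u \<bullet> b"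
  have le: "l $ i \<le> u $ i" for i using lu[of "axis i 1"] by (auto simp: inner_axis Basis_vec_def)
  have "emeasure (distr lborel borel (\<lambda>(x, y). vector [x, y])) (box l u)
      = emeasure lborel (box (l $ 1, l $ 2) (u $ 1, u $ 2))"
    by (subst emeasure_distr) (auto intro!: arg_cong[where f="emeasure lborel"]
        simp: mem_box_cart mem_box Basis_prod_def forall_2)
  also have "\<dots> = ennreal ((u $ 1 - l $ 1) * (u $ 2 - l $ 2))"
    using le by (simp add: emeasure_lborel_box_eq Basis_prod_def inner_prod_def prod.union_disjoint)
  also have "(u $ 1 - l $ 1) * (u $ 2 - l $ 2) = (\<Prod>b\<in>Basis. (u - l) \<bullet> b)"
    by (simp add: Basis_vec_def inner_axis UNIV_2 axis_eq_axis)
  finally show "emeasure (distr lborel borel (\<lambda>(x, y). vector [x, y])) (box l u) = (\<Prod>b\<in>Basis. (u - l) \<bullet> b)" .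
qed simp

lemma emeasure_lborel_vec2:
  assumes [measurable]: "S \<in> sets (borel :: (real^2) measure)"
  shows "emeasure lborel S = (\<integral>\<^sup>+t. emeasure lborel {u. vector [u, t] \<in> S} \<partial>lborel)"
proof -
  have "emeasure lborel S = emeasure (lborel :: (real \<times> real) measure) ((\<lambda>(x, y). vector [x, y]) -` S)"
    by (subst lborel_vec2[symmetric]) (simp add: emeasure_distr measurable_vec2)
  also have "\<dots> = emeasure (lborel \<Otimes>\<^sub>M lborel) ((\<lambda>(x, y). vector [x, y]) -` S)"
    by (simp add: lborel_prod)
  also have "\<dots> = (\<integral>\<^sup>+t. emeasure lborel ((\<lambda>u. (u, t)) -` (\<lambda>(x, y). vector [x, y]) -` S) \<partial>lborel)"
    using measurable_sets[OF measurable_vec2 assms]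
    by (intro lborel_pair.emeasure_pair_measure_alt2)
       (simp only: lborel_prod sets_lborel space_borel Int_UNIV_right)
  finally show ?thesis by (simp add: vimage_def)
qed

section \<open>Chords from an interior or boundary point of a disk\<close>

text \<open>Here \<open>y\<close> is the larger root of the quadratic equation
  \<open>(norm (w + s *\<^sub>R e))\<^sup>2 = c\<^sup>2\<close> in \<open>s\<close>. Since
  \<open>norm w \<le> c\<close>, the other root is at most 0 and does not matter for positive
  \<open>s\<close>.\<close>

lemma norm_ray_compare:
  fixes w e :: "'a::real_inner"
  assumes "norm e = 1" "norm w \<le> c" "0 < s"
  defines "y \<equiv> sqrt (c\<^sup>2 - w \<bullet> w + (w \<bullet> e)\<^sup>2) - w \<bullet> e"
  shows "norm (w + s *\<^sub>R e) \<le> c \<longleftrightarrow> s \<le> y" "norm (w + s *\<^sub>R e) < c \<longleftrightarrow> s < y" "0 \<le> y"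
proof -
  define p q where "p = w \<bullet> e" and "q = sqrt (c\<^sup>2 - w \<bullet> w + p\<^sup>2)"
  have c: "0 \<le> c" using assms(2) norm_ge_zero order_trans by blast
  have "w \<bullet> w \<le> c\<^sup>2"
    using assms(2) by (simp add: dot_square_norm power_mono)
  then have q: "q\<^sup>2 = c\<^sup>2 - w \<bullet> w + p\<^sup>2" "\<bar>p\<bar> \<le> q"
    unfolding q_def by (auto intro!: real_le_rsqrt)
  have "e \<bullet> e = 1" using assms(1) by (simp add: dot_square_norm)
  then have N: "(norm (w + s *\<^sub>R e))\<^sup>2 = (s + p)\<^sup>2 + c\<^sup>2 - q\<^sup>2"
    unfolding q p_def
    unfolding power2_norm_eq_inner by (simp add: inner_simps inner_commute algebra_simps power2_eq_square)
  have "norm (w + s *\<^sub>R e) \<le> c \<longleftrightarrow> (s + p)\<^sup>2 \<le> q\<^sup>2"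
    using c N by (subst power_mono_iff[symmetric, where n=2]) auto
  also have "\<dots> \<longleftrightarrow> \<bar>s + p\<bar> \<le> q"
    using q(2) by (simp add: abs_le_square_iff[symmetric])
  finally show "norm (w + s *\<^sub>R e) \<le> c \<longleftrightarrow> s \<le> y"
    using q(2) assms(3) by (auto simp: y_def q_def p_def)
  have "norm (w + s *\<^sub>R e) < c \<longleftrightarrow> (s + p)\<^sup>2 < q\<^sup>2"
    using c N power_mono_iff[of c "norm (w + s *\<^sub>R e)" 2] by auto
  also have "\<dots> \<longleftrightarrow> \<bar>s + p\<bar> < q"
    using q(2) abs_le_square_iff[of q "s + p"] by (auto simp: not_le[symmetric])
  finally show "norm (w + s *\<^sub>R e) < c \<longleftrightarrow> s < y"
    using q(2) assms(3) by (auto simp: y_def q_def p_def)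
  show "0 \<le> y" using q(2) by (auto simp: y_def q_def p_def)
qed

text \<open>Half the squared distance from \<open>P\<close> to the circle of radius \<open>c\<close> around \<open>P - w\<close> in direction \<open>t\<close>.\<close>

definition half_sq_chord :: "real^2 \<Rightarrow> real \<Rightarrow> real \<Rightarrow> real" where
  "half_sq_chord w c t = (sqrt (c\<^sup>2 - w \<bullet> w + (w \<bullet> unit2 t)\<^sup>2) - w \<bullet> unit2 t)\<^sup>2 / 2"

text \<open>Along each ray from \<open>P\<close> the disk becomes an upper bound on the first
  coordinate, because \<open>sqrt (2 * u) \<le> y\<close> amounts to
  \<open>u \<le> y\<^sup>2 / 2\<close>.\<close>

lemma polar_compare:
  assumes "norm (P - Q) \<le> c" "0 < v $ 1"
  shows "polar P v \<in> cball Q c \<longleftrightarrow> v $ 1 \<le> half_sq_chord (P - Q) c (v $ 2)"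
    and "polar P v \<in> ball Q c \<longleftrightarrow> v $ 1 < half_sq_chord (P - Q) c (v $ 2)"
proof -
  have d: "dist Q (polar P v) = norm ((P - Q) + sqrt (2 * v $ 1) *\<^sub>R unit2 (v $ 2))"
    by (simp add: dist_norm polar_def norm_minus_commute algebra_simps)
  have *: "sqrt (2 * x) \<le> y \<longleftrightarrow> x \<le> y\<^sup>2 / 2" "sqrt (2 * x) < y \<longleftrightarrow> x < y\<^sup>2 / 2"
    if "0 \<le> y" "0 < x" for x y :: real
    using that real_sqrt_le_iff[of "2 * x" "y\<^sup>2"] real_sqrt_less_iff[of "2 * x" "y\<^sup>2"] by auto
  note n = norm_ray_compare[OF norm_unit2 assms(1), of "sqrt (2 * v $ 1)" "v $ 2"]
  show "polar P v \<in> cball Q c \<longleftrightarrow> v $ 1 \<le> half_sq_chord (P - Q) c (v $ 2)"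
    using assms(2) n unfolding mem_cball d half_sq_chord_def by (subst n(1)) (auto simp: *)
  show "polar P v \<in> ball Q c \<longleftrightarrow> v $ 1 < half_sq_chord (P - Q) c (v $ 2)"
    using assms(2) n unfolding mem_ball d half_sq_chord_def by (subst n(2)) (auto simp: *)
qed

lemma half_sq_chord_nonneg: "0 \<le> half_sq_chord w c t"
  by (simp add: half_sq_chord_def)

lemma half_sq_chord_mono:
  assumes "norm w \<le> c" "c \<le> d"
  shows "half_sq_chord w c t \<le> half_sq_chord w d t"
proof -
  have "0 \<le> c" using assms(1) norm_ge_zero order_trans by blast
  then have "c\<^sup>2 \<le> d\<^sup>2" using assms(2) by (simp add: power_mono)
  then show ?thesis
    \<comment> \<open>Squaring preserves the order because the root for radius \<open>c\<close> is
      nonnegative; 1 is an arbitrary positive \<open>s\<close>.\<close>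
    using norm_ray_compare(3)[OF norm_unit2 assms(1), of 1 t]
    unfolding half_sq_chord_def by (auto intro!: divide_right_mono power_mono)
qed

text \<open>Reversing the direction flips the sign of \<open>w \<bullet> unit2 t\<close>, so the
  cross terms of the two squares, which contain the square root, cancel.\<close>

lemma half_sq_chord_opposite:
  assumes "norm w \<le> c"
  shows "half_sq_chord w c t + half_sq_chord w c (t - pi) = c\<^sup>2 - w \<bullet> w + 2 * (w \<bullet> unit2 t)\<^sup>2"
proof -
  have "w \<bullet> w \<le> c\<^sup>2"
    using assms by (simp add: dot_square_norm power_mono)
  then have "(sqrt (c\<^sup>2 - w \<bullet> w + (w \<bullet> unit2 t)\<^sup>2))\<^sup>2 = c\<^sup>2 - w \<bullet> w + (w \<bullet> unit2 t)\<^sup>2"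
    by simp
  then show ?thesis
    unfolding half_sq_chord_def unit2_minus_pi by (simp add: power2_diff power2_sum field_simps)
qed

section \<open>Area of a sector of the annulus\<close>

text \<open>Up to the point \<open>P\<close>, the sector is the polar image of a set
  \<open>S\<close> of the same measure, whose slice at angle \<open>t\<close> is an interval between
  the two values of \<open>half_sq_chord\<close>.\<close>

lemma annulus_sector:
  assumes "P \<in> cball Q r" "r \<le> R" "b - a < 2 * pi"
  defines "X \<equiv> (cball Q R - ball Q r) \<inter> angular_sector P a b"
  shows "X \<in> lmeasurable"
    and "emeasure lebesgue X
      = (\<integral>\<^sup>+t. ennreal (half_sq_chord (P - Q) R t - half_sq_chord (P - Q) r t) * indicator {a..b} t \<partial>lborel)"
proof -
  define S where "S = {v. 0 < v $ 1 \<and> v $ 2 \<in> {a..b} \<and> polar P v \<in> cball Q R - ball Q r}"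
  have w: "norm (P - Q) \<le> r" "norm (P - Q) \<le> R"
    using assms by (auto simp: dist_norm norm_minus_commute)
  have S_borel: "S \<in> sets borel"
  proof -
    have "S = {v. 0 < v $ 1} \<inter> {v. a \<le> v $ 2} \<inter> {v. v $ 2 \<le> b} \<inter> polar P -` (cball Q R - ball Q r)"
      by (auto simp: S_def)
    moreover have "closed (polar P -` (cball Q R - ball Q r))"
      by (intro closed_vimage closed_Diff continuous_on_polar) auto
    ultimately show ?thesis
      by (auto intro!: sets.Int borel_closed borel_open open_Collect_less closed_Collect_le continuous_intros)
  qed
  \<comment> \<open>Points of the outer disk are within \<open>2 * R\<close> of \<open>P\<close>,
    hence half the squared distance is at most \<open>2 * R\<^sup>2\<close>.\<close>
  have "S \<subseteq> cbox (vector [0, a]) (vector [2 * R\<^sup>2, b])"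
  proof
    fix v assume v: "v \<in> S"
    then have "0 < v $ 1" "polar P v \<in> cball Q R" by (auto simp: S_def)
    moreover have "sqrt (2 * v $ 1) = dist P (polar P v)"
      using \<open>0 < v $ 1\<close> by (simp add: polar_def dist_norm)
    moreover have "dist P (polar P v) \<le> dist Q P + dist Q (polar P v)"
      by (metis dist_commute dist_triangle)
    ultimately have "sqrt (2 * v $ 1) \<le> 2 * R"
      using assms(1,2) by auto
    then have "2 * v $ 1 \<le> (2 * R)\<^sup>2" by (rule sqrt_le_D)
    then show "v \<in> cbox (vector [0, a]) (vector [2 * R\<^sup>2, b])"
      using v by (auto simp: S_def mem_box_cart forall_2)
  qed
  then have S: "S \<in> lmeasurable"
    using S_borel by (intro bounded_set_imp_lmeasurable bounded_subset[OF bounded_cbox]) auto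
  have S': "S \<subseteq> {v. 0 < v $ 1 \<and> v $ 2 \<in> {a..b}}" by (auto simp: S_def)
  note im = measure_polar_image[OF S S' assms(3), of P]
  \<comment> \<open>\<open>P\<close> can belong to \<open>X\<close> if it lies on the inner circle,
    but it is never in the image, where the radius is positive.\<close>
  have "X - {P} = polar P ` S - {P}"
  proof (intro set_eqI iffI)
    fix x assume "x \<in> X - {P}"
    then obtain s t where st: "x \<in> cball Q R - ball Q r" "x \<noteq> P" "t \<in> {a..b}" "0 \<le> s" "x = P + s *\<^sub>R unit2 t"
      unfolding X_def angular_sector_def ray_def unit2_def by auto
    then have "0 < s" by (cases "s = 0") auto
    with st have "vector [s\<^sup>2 / 2, t] \<in> S" "x = polar P (vector [s\<^sup>2 / 2, t])"
      by (auto simp: S_def polar_def)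
    with st show "x \<in> polar P ` S - {P}" by blast
  next
    fix x assume "x \<in> polar P ` S - {P}"
    then obtain v where v: "v \<in> S" "x = polar P v" "x \<noteq> P" by auto
    then have "x \<in> ray P (v $ 2)" "v $ 2 \<in> {a..b}"
      unfolding ray_def by (auto simp: S_def polar_def unit2_def intro!: exI[of _ "sqrt (2 * v $ 1)"])
    with v show "x \<in> X - {P}" by (auto simp: X_def angular_sector_def S_def)
  qed
  then have N: "negligible ((polar P ` S - X) \<union> (X - polar P ` S))"
    by (intro negligible_subset[OF negligible_sing[of P]]) auto
  show X: "X \<in> lmeasurable"
    by (rule lmeasurable_negligible_symdiff[OF im(1) N])
  have "measure lebesgue X = measure lebesgue S"
    using measure_negligible_symdiff[OF im(1) N] im(2) by simp
  then have "emeasure lebesgue X = emeasure lebesgue S"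
    using X S by (simp add: emeasure_eq_measure2)
  also have "\<dots> = emeasure lborel S"
    using S_borel by simp
  also have "\<dots> = (\<integral>\<^sup>+t. emeasure lborel {u. vector [u, t] \<in> S} \<partial>lborel)"
    by (rule emeasure_lborel_vec2[OF S_borel])
  also have "\<dots> = (\<integral>\<^sup>+t. ennreal (half_sq_chord (P - Q) R t - half_sq_chord (P - Q) r t) * indicator {a..b} t \<partial>lborel)"
  proof (intro nn_integral_cong)
    fix t
    let ?l = "half_sq_chord (P - Q) r t" and ?u = "half_sq_chord (P - Q) R t"
    show "emeasure lborel {u. vector [u, t] \<in> S} = ennreal (?u - ?l) * indicator {a..b} t"
    proof (cases "t \<in> {a..b}")
      case True
      then have "{u. vector [u, t] \<in> S} = {u. 0 < u \<and> ?l \<le> u \<and> u \<le> ?u}"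
        using polar_compare(1)[OF w(2), of "vector [_, t]"] polar_compare(2)[OF w(1), of "vector [_, t]"]
        by (auto simp: S_def simp del: mem_ball mem_cball)
      \<comment> \<open>If \<open>?l = 0\<close>, the condition \<open>0 < u\<close> removes the
        left endpoint; the length is the same in both cases.\<close>
      also have "\<dots> = (if ?l = 0 then {0<..?u} else {?l..?u})"
        using half_sq_chord_nonneg[of "P - Q" r t] by auto
      finally show ?thesis
        using True half_sq_chord_mono[OF w(1) assms(2), of t] by (simp split: if_splits)
    next
      case False
      then have "{u. vector [u, t] \<in> S} = {}" by (auto simp: S_def)
      with False show ?thesis by simp
    qed
  qed
  finally show "emeasure lebesgue X
      = (\<integral>\<^sup>+t. ennreal (half_sq_chord (P - Q) R t - half_sq_chord (P - Q) r t) * indicator {a..b} t \<partial>lborel)" .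
qed

section \<open>Opposite sectors\<close>

lemma vertical_sectors:
  assumes "P \<in> cball Q r" "r \<le> R" "a \<le> b" "b - a < 2 * pi"
  shows "area ((cball Q R - ball Q r) \<inter> angular_sector P a b)
       + area ((cball Q R - ball Q r) \<inter> angular_sector P (a - pi) (b - pi)) = (b - a) * (R\<^sup>2 - r\<^sup>2)"
proof -
  let ?X = "\<lambda>a b. (cball Q R - ball Q r) \<inter> angular_sector P a b"
  define g where "g t = half_sq_chord (P - Q) R t - half_sq_chord (P - Q) r t" for t
  have w: "norm (P - Q) \<le> r" "norm (P - Q) \<le> R"
    using assms by (auto simp: dist_norm norm_minus_commute)
  have [measurable]: "g \<in> borel_measurable borel"
    unfolding g_def half_sq_chord_def
    by (intro borel_measurable_continuous_onI continuous_intros) auto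
  have g0: "0 \<le> g t" for t
    using half_sq_chord_mono[OF w(1) assms(2)] by (simp add: g_def)
  have gsum: "g t + g (t - pi) = R\<^sup>2 - r\<^sup>2" for t
    using half_sq_chord_opposite[OF w(1), of t] half_sq_chord_opposite[OF w(2), of t] by (simp add: g_def)
  have "emeasure lebesgue (?X (a - pi) (b - pi)) = (\<integral>\<^sup>+t. ennreal (g t) * indicator {a - pi..b - pi} t \<partial>lborel)"
    using annulus_sector(2)[OF assms(1,2), of "b - pi" "a - pi"] assms by (simp add: g_def)
  \<comment> \<open>A translation by \<open>pi\<close> brings both integrals to the same range, so
    that the integrands can be added pointwise with \<open>gsum\<close>.\<close>
  also have "\<dots> = (\<integral>\<^sup>+t. ennreal (g (t - pi)) * indicator {a..b} t \<partial>lborel)"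
    by (subst nn_integral_real_affine[where c = 1 and t = "- pi"])
       (auto intro!: nn_integral_cong simp: indicator_def)
  finally have "emeasure lebesgue (?X a b) + emeasure lebesgue (?X (a - pi) (b - pi))
     = (\<integral>\<^sup>+t. ennreal (g t) * indicator {a..b} t \<partial>lborel) + (\<integral>\<^sup>+t. ennreal (g (t - pi)) * indicator {a..b} t \<partial>lborel)"
    using annulus_sector(2)[OF assms(1,2,4)] by (simp add: g_def)
  also have "\<dots> = (\<integral>\<^sup>+t. ennreal (g t) * indicator {a..b} t + ennreal (g (t - pi)) * indicator {a..b} t \<partial>lborel)"
    by (rule nn_integral_add[symmetric]) measurable
  also have "\<dots> = (\<integral>\<^sup>+t. ennreal (R\<^sup>2 - r\<^sup>2) * indicator {a..b} t \<partial>lborel)"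
    using g0 by (intro nn_integral_cong) (simp add: gsum distrib_right[symmetric] flip: ennreal_plus)
  also have "\<dots> = ennreal ((R\<^sup>2 - r\<^sup>2) * (b - a))"
    \<comment> \<open>The nonnegativity of \<open>R\<^sup>2 - r\<^sup>2\<close> is read off from
      \<open>gsum\<close> at angle 0, as a sum of two values of \<open>g\<close>.\<close>
    using assms(3) gsum[of 0] g0[of 0] g0[of "0 - pi"]
    by (simp add: nn_integral_cmult_indicator ennreal_mult)
  finally have "emeasure lebesgue (?X a b) + emeasure lebesgue (?X (a - pi) (b - pi)) = ennreal ((R\<^sup>2 - r\<^sup>2) * (b - a))" .
  moreover have "?X a b \<in> lmeasurable" "?X (a - pi) (b - pi) \<in> lmeasurable"
    using annulus_sector(1)[OF assms(1,2)] assms(4) by auto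
  moreover have "0 \<le> (R\<^sup>2 - r\<^sup>2) * (b - a)"
    using assms(3) gsum[of 0] g0[of 0] g0[of "0 - pi"] by auto
  ultimately show ?thesis
    by (simp add: area_def emeasure_eq_measure2 mult.commute flip: ennreal_plus)
qed

lemma area_annulus:
  fixes Q :: "real^2"
  assumes "0 \<le> r" "r \<le> R"
  shows "area (cball Q R - ball Q r) = pi * (R\<^sup>2 - r\<^sup>2)"
proof -
  have "ball Q r \<subseteq> cball Q R" using assms by auto
  then have "area (cball Q R - ball Q r) = measure lebesgue (cball Q R) - measure lebesgue (ball Q r)"
    unfolding area_def by (intro measurable_measure_Diff) auto
  also have "\<dots> = measure lborel (cball Q R) - measure lborel (ball Q r)"
    by simp
  also have "\<dots> = pi * (R\<^sup>2 - r\<^sup>2)"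
    using assms by (simp add: content_cball content_ball unit_ball_vol_2 algebra_simps power2_eq_square)
  finally show ?thesis .
qed

theorem theorem1:
  fixes D D' B :: "(real^2) set"
    and ctr P :: "real^2"
    and R r \<alpha> :: real
    and n k :: nat
    and A :: "nat \<Rightarrow> real^2"
  assumes "R > 0" and "r > 0"
    and "D = cball ctr R" and "D' = cball ctr r" and "D' \<subseteq> D"
    and "B = D - interior D'"
    and "P \<in> D'"
    and "n \<ge> 4" and "even n"
    and "\<And>i. i \<in> {1..2 * n} \<Longrightarrow> A i \<in> ray P (ray_arg \<alpha> n i) \<inter> frontier D"
    and "k \<in> {1..n}"
  shows "piece_area B P \<alpha> n k + piece_area B P \<alpha> n (k + n) = 1 / real n * area B"
proof -
  have "r \<le> R"
    using assms(1-5) by (simp add: cball_subset_cball_iff)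
  have B: "B = cball ctr R - ball ctr r"
    by (simp add: assms)
  have n: "0 < real n" using assms by simp
  \<comment> \<open>Raising the index by \<open>n\<close> is a clockwise half turn, which matches
    the shift by \<open>- pi\<close> in \<open>vertical_sectors\<close>.\<close>
  have shift: "ray_arg \<alpha> n (j + n) = ray_arg \<alpha> n j - pi" for j
    using n by (simp add: ray_arg_def field_simps)
  have width: "ray_arg \<alpha> n k - ray_arg \<alpha> n (k + 1) = pi / n"
    using n by (simp add: ray_arg_def field_simps)
  then have le: "ray_arg \<alpha> n (k + 1) \<le> ray_arg \<alpha> n k"
    using n pi_gt_zero by (smt (verit) divide_pos_pos)
  \<comment> \<open>The sector must be narrower than a full turn for polar coordinates to be
    injective on it.\<close>
  have "pi / n \<le> pi" using n assms(8) by (simp add: field_simps)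
  then have "pi / n < 2 * pi" using pi_gt_zero by linarith
  then have "piece_area B P \<alpha> n k + piece_area B P \<alpha> n (k + n) = pi / n * (R\<^sup>2 - r\<^sup>2)"
    using vertical_sectors[of P ctr r R "ray_arg \<alpha> n (k + 1)" "ray_arg \<alpha> n k"] assms(4,7) \<open>r \<le> R\<close> width le
    by (simp add: piece_area_def B shift[of k] shift[of "k + 1", simplified])
  also have "\<dots> = 1 / real n * area B"
    using area_annulus[of r R ctr] assms(2) \<open>r \<le> R\<close> by (simp add: B)
  finally show ?thesis .
qed

end
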